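(* Let $A\in\mathbb{R}^{n\times n}$ be invertible, let $U,V\in\mathbb{R}^{n\times k}$ have full column rank, assume $I+V^TA^{-1}U$ is invertible, and let $B=A+UV^T$. Let $\widetilde{A}^{-1}\in\mathbb{R}^{n\times n}$ and $Z^{-1}\in\mathbb{R}^{k\times k}$ be approximate inverses with errors $\epsilon_1=\|\widetilde{A}^{-1}-A^{-1}\|_2$ and $\epsilon_2=\|Z^{-1}-(I+V^T\widetilde{A}^{-1}U)^{-1}\|_2$, where $I+V^T\widetilde{A}^{-1}U$ is invertible, and let $\lambda=\|U\|_2\|V\|_2$. Let $\alpha$ satisfy $\|(I+V^TA^{-1}U)^{-1}\|_2\le\alpha$. Assume that $\epsilon_1\le1$, $\epsilon_2\le1$, $\sigma_{\min}(A)\le1$, $\epsilon_1<\frac{1}{2\lambda\alpha}$, and $\lambda\le\frac12\sigma_{\min}(A)$. Then $$\left\|B^{-1}-\left(\widetilde{A}^{-1}-\widetilde{A}^{-1}UZ^{-1}V^T\widetilde{A}^{-1}\right)\right\|_2\le 2\epsilon_2\|A^{-1}\|_2+12\epsilon_1.$$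
   Context: $\|\cdot\|_2$ is the spectral norm, $\sigma_{\min}(A)$ is the smallest singular value of $A$, and $I$ is the identity matrix of appropriate size. $\widetilde{A}^{-1}$ is a single symbol for a given $n\times n$ matrix (the computed approximation of $A^{-1}$), and $Z^{-1}$ is a single symbol for a given $k\times k$ matrix (the computed approximation of $(I+V^T\widetilde{A}^{-1}U)^{-1}$). *)

theory Defs
  imports "HOL-Analysis.Analysis"
begin

text \<open>The norm on \<^typ>\<open>real ^ 'n\<close> is Euclidean, so its operator norm is the spectral norm.\<close>

abbreviation spectral_norm :: "real ^ 'n ^ 'm \<Rightarrow> real" where
  "spectral_norm A \<equiv> onorm (\<lambda>x. A *v x)"

text \<open>Restricted to square matrices: for a wide matrix the eigenvalues of
  \<open>A\<^sup>T A\<close> would contribute spurious zeros.\<close>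

definition singular_values :: "real ^ 'n ^ 'n \<Rightarrow> real set" where
  "singular_values A =
     {sqrt \<mu> | \<mu>. \<exists>v. v \<noteq> 0 \<and> (transpose A ** A) *v v = \<mu> *\<^sub>R v}"

definition sigma_min :: "real ^ 'n ^ 'n \<Rightarrow> real" where
  "sigma_min A = Min (singular_values A)"

end

theory Submission
  imports Defs
begin

text \<open>
  Write \<open>M\<close> for the inverse of \<open>A\<close>, \<open>N\<close> for its approximation, and \<open>K'\<close>, \<open>L'\<close> for the inverses of
  \<open>I + V\<^sup>T M U\<close> and \<open>I + V\<^sup>T N U\<close>. By the Woodbury identity the error telescopes into
  \<open>(M - N) + (N - M) U L' V\<^sup>T N + M U (L' - K') V\<^sup>T N + M U K' V\<^sup>T (N - M) + N U (Z - L') V\<^sup>T N\<close>.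
  The bounds on \<open>\<lambda>\<close> and \<open>\<sigma>\<^sub>m\<^sub>i\<^sub>n\<close> give \<open>\<lambda> \<parallel>M\<parallel> \<le> 1/2\<close> and \<open>\<lambda> \<le> 1/2\<close>; so \<open>\<parallel>K'\<parallel> \<le> 2\<close> by a Neumann-type argument,
  and then \<open>\<parallel>L'\<parallel> \<le> 4\<close> because \<open>\<lambda> \<epsilon>\<^sub>1 \<parallel>K'\<parallel> \<le> 1/2\<close>. The five terms are bounded by
  \<open>\<epsilon>\<^sub>1\<close>, \<open>4 \<epsilon>\<^sub>1\<close>, \<open>4 \<epsilon>\<^sub>1\<close>, \<open>\<epsilon>\<^sub>1\<close> and \<open>\<epsilon>\<^sub>2 (\<parallel>M\<parallel> + \<epsilon>\<^sub>1)\<close>.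
\<close>

section \<open>The spectral norm\<close>

lemma spectral_norm_nonneg: "0 \<le> spectral_norm (A :: real^'n^'m)"
  by (rule onorm_pos_le[OF matrix_vector_mul_bounded_linear])

lemma norm_matrix_vector_le: "norm (A *v x) \<le> spectral_norm A * norm x"
  for A :: "real^'n^'m"
  by (rule onorm[OF matrix_vector_mul_bounded_linear])

lemma spectral_norm_add_le: "spectral_norm (A + B) \<le> spectral_norm A + spectral_norm B"
  for A B :: "real^'n^'m"
  using onorm_triangle[OF matrix_vector_mul_bounded_linear matrix_vector_mul_bounded_linear, of A B]
  by (simp add: matrix_vector_mult_add_rdistrib)

lemma spectral_norm_diff_commute: "spectral_norm (A - B) = spectral_norm (B - A)"
  for A B :: "real^'n^'m"
  using onorm_neg[of "\<lambda>x. (A - B) *v x"] by (simp add: matrix_vector_mult_diff_rdistrib)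

lemma spectral_norm_mult_le: "spectral_norm (A ** B) \<le> spectral_norm A * spectral_norm B"
  for A :: "real^'n^'m" and B :: "real^'k^'n"
  using onorm_compose[OF matrix_vector_mul_bounded_linear matrix_vector_mul_bounded_linear, of A B]
  by (simp add: o_def matrix_vector_mul_assoc)

lemma spectral_norm_mult_mono:
  fixes A :: "real^'n^'m" and B :: "real^'k^'n"
  assumes "spectral_norm A \<le> a" and "spectral_norm B \<le> b"
  shows "spectral_norm (A ** B) \<le> a * b"
proof -
  have "spectral_norm A * spectral_norm B \<le> a * b"
    using assms spectral_norm_nonneg[of A] spectral_norm_nonneg[of B] by (intro mult_mono) auto
  then show ?thesis
    using spectral_norm_mult_le[of A B] by linarith
qed

lemma inner_matrix_vector_transpose: "(A *v x) \<bullet> y = x \<bullet> (transpose A *v y)"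
  for A :: "real^'n^'m"
  by (metis dot_lmul_matrix inner_commute transpose_matrix_vector)

text \<open>Cauchy-Schwarz bounds the square of \<open>norm (transpose A *v x)\<close> by a product
  containing that same norm, so one factor cancels; the zero case is split off for this.\<close>

lemma spectral_norm_transpose_le: "spectral_norm (transpose A) \<le> spectral_norm A"
  for A :: "real^'n^'m"
proof (rule onorm_le)
  fix x :: "real^'m"
  let ?y = "transpose A *v x"
  have "norm ?y * norm ?y = (A *v ?y) \<bullet> x"
    by (simp add: inner_matrix_vector_transpose dot_square_norm power2_eq_square)
  also have "\<dots> \<le> norm (A *v ?y) * norm x"
    by (rule norm_cauchy_schwarz)
  also have "\<dots> \<le> spectral_norm A * norm ?y * norm x"
    by (intro mult_right_mono norm_matrix_vector_le) simp
  finally show "norm ?y \<le> spectral_norm A * norm x"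
    using spectral_norm_nonneg[of A]
    by (cases "norm ?y = 0") (auto simp: mult_ac)
qed

section \<open>The smallest singular value\<close>

text \<open>Eigenvectors of a symmetric matrix for distinct eigenvalues are orthogonal, hence
  independent, so there are finitely many eigenvalues. Finiteness is what lets \<open>Min\<close> in
  \<open>sigma_min\<close> act as a lower bound.\<close>

lemma finite_singular_values: "finite (singular_values (A :: real^'n^'n))"
proof -
  define S where "S = transpose A ** A"
  define E where "E = {\<mu>. \<exists>v. v \<noteq> 0 \<and> S *v v = \<mu> *\<^sub>R v}"
  define f where "f \<mu> = (SOME v. v \<noteq> 0 \<and> S *v v = \<mu> *\<^sub>R v)" for \<mu>
  have f: "f \<mu> \<noteq> 0 \<and> S *v f \<mu> = \<mu> *\<^sub>R f \<mu>" if "\<mu> \<in> E" for \<mu>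
    using someI_ex[of "\<lambda>v. v \<noteq> 0 \<and> S *v v = \<mu> *\<^sub>R v"] that unfolding E_def f_def by blast
  have sym: "(S *v x) \<bullet> y = x \<bullet> (S *v y)" for x y
    by (simp add: S_def inner_matrix_vector_transpose matrix_transpose_mul)
  have inj: "inj_on f E"
    by (rule inj_onI) (metis f scaleR_right_imp_eq)
  have "orthogonal (f \<mu>) (f \<nu>)" if "\<mu> \<in> E" "\<nu> \<in> E" "\<mu> \<noteq> \<nu>" for \<mu> \<nu>
    using sym[of "f \<mu>" "f \<nu>"] f[OF that(1)] f[OF that(2)] that(3) by (simp add: orthogonal_def)
  then have "pairwise orthogonal (f ` E)"
    by (auto simp: pairwise_def)
  then have "independent (f ` E)"
    using f by (intro pairwise_orthogonal_independent) auto
  then have "finite E"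
    using independent_imp_finite finite_imageD inj by blast
  moreover have "singular_values A = sqrt ` E"
    by (auto simp: singular_values_def E_def S_def)
  ultimately show ?thesis by simp
qed

text \<open>The minimiser of \<open>norm (A *v x)\<close> on the unit sphere is an eigenvector of \<open>A\<^sup>T A\<close>.\<close>

lemma minimal_stretch_singular_value:
  fixes A :: "real^'n^'n"
  obtains s where "0 \<le> s" and "s \<in> singular_values A" and "\<And>x. s * norm x \<le> norm (A *v x)"
proof -
  have "compact (sphere (0::real^'n) 1)" "sphere (0::real^'n) 1 \<noteq> {}"
    by auto
  moreover have "continuous_on (sphere (0::real^'n) 1) (\<lambda>x. norm (A *v x))"
    by (intro continuous_on_norm linear_continuous_on matrix_vector_mul_bounded_linear)
  ultimately obtain v where v: "norm v = 1"
      and vmin: "\<And>x. norm x = 1 \<Longrightarrow> norm (A *v v) \<le> norm (A *v x)"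
    using continuous_attains_inf by (metis (no_types, lifting) dist_0_norm mem_sphere)
  define s where "s = norm (A *v v)"
  have s: "s * norm x \<le> norm (A *v x)" for x
  proof (cases "x = 0")
    case False
    have "s \<le> norm (A *v ((1 / norm x) *\<^sub>R x))"
      unfolding s_def using False by (intro vmin) simp
    also have "\<dots> = norm (A *v x) / norm x"
      by (simp add: matrix_vector_mult_scaleR)
    finally show ?thesis using False by (simp add: field_simps)
  qed simp
  \<comment> \<open>The quadratic form \<open>q\<close> is nonnegative and vanishes at
    \<open>v\<close>; \<open>w\<close> below is half its gradient there. A short step against the
    gradient would make \<open>q\<close> negative unless \<open>w = 0\<close>.\<close>
  define q where "q x = (norm (A *v x))\<^sup>2 - s\<^sup>2 * (norm x)\<^sup>2" for x
  have q_nonneg: "0 \<le> q x" for x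
    using power_mono[OF s[of x], of 2] by (simp add: q_def s_def power_mult_distrib)
  define w where "w = (transpose A ** A) *v v - s\<^sup>2 *\<^sub>R v"
  have q_line: "q (v - t *\<^sub>R w) = t\<^sup>2 * q w - 2 * t * (w \<bullet> w)" for t
  proof -
    have "(A *v w) \<bullet> (A *v v) = w \<bullet> ((transpose A ** A) *v v)"
      by (simp add: inner_matrix_vector_transpose matrix_vector_mul_assoc)
    then have "(A *v w) \<bullet> (A *v v) = w \<bullet> w + s\<^sup>2 * (w \<bullet> v)"
      by (simp add: w_def inner_diff_left inner_diff_right)
    then have cross: "(A *v v) \<bullet> (A *v w) = w \<bullet> w + s\<^sup>2 * (v \<bullet> w)"
      by (simp add: inner_commute)
    have expand: "(norm (x - t *\<^sub>R y))\<^sup>2 = (norm x)\<^sup>2 - 2 * t * (x \<bullet> y) + t\<^sup>2 * (norm y)\<^sup>2"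
      for x y :: "real^'n"
      unfolding power2_norm_eq_inner
      by (simp add: inner_diff_left inner_diff_right inner_commute[of y x] power2_eq_square right_diff_distrib)
    have "A *v (v - t *\<^sub>R w) = A *v v - t *\<^sub>R (A *v w)"
      by (simp add: matrix_vector_mult_diff_distrib matrix_vector_mult_scaleR)
    then have "q (v - t *\<^sub>R w) = s\<^sup>2 - 2 * t * (w \<bullet> w + s\<^sup>2 * (v \<bullet> w)) + t\<^sup>2 * (norm (A *v w))\<^sup>2
        - s\<^sup>2 * (1 - 2 * t * (v \<bullet> w) + t\<^sup>2 * (norm w)\<^sup>2)"
      by (simp only: q_def expand cross v s_def[symmetric] power_one)
    then show ?thesis
      by (simp add: q_def right_diff_distrib distrib_left)
  qed
  have "w = 0"
  proof (rule ccontr)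
    assume "w \<noteq> 0"
    then have p: "0 < w \<bullet> w" by simp
    \<comment> \<open>Any positive \<open>t\<close> with
      \<open>t * q w < 2 * (w \<bullet> w)\<close> makes \<open>q_line\<close> negative; the
      \<open>+ 1\<close> keeps the denominator positive when \<open>q w = 0\<close>.\<close>
    define t where "t = (w \<bullet> w) / (q w + 1)"
    have t: "0 < t" using p q_nonneg[of w] by (simp add: t_def)
    have "t * q w \<le> t * (q w + 1)" using t by simp
    also have "\<dots> = w \<bullet> w" using q_nonneg[of w] by (simp add: t_def)
    finally have "t * q w < 2 * (w \<bullet> w)" using p by linarith
    then have "t * (t * q w) < t * (2 * (w \<bullet> w))" using t by (rule mult_strict_left_mono)
    then show False
      using q_nonneg[of "v - t *\<^sub>R w"] by (simp add: q_line power2_eq_square algebra_simps)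
  qed
  then have "(transpose A ** A) *v v = s\<^sup>2 *\<^sub>R v"
    by (simp add: w_def)
  moreover have "v \<noteq> 0" using v by auto
  moreover have "s = sqrt (s\<^sup>2)" by (simp add: s_def)
  ultimately have "s \<in> singular_values A"
    unfolding singular_values_def by blast
  then show thesis
    using that[of s] s by (simp add: s_def)
qed

lemma matrix_inv_mult:
  fixes A :: "real^'n^'n"
  assumes "invertible A"
  shows "A ** matrix_inv A = mat 1" and "matrix_inv A ** A = mat 1"
  using someI_ex[OF assms[unfolded invertible_def]] by (simp_all add: matrix_inv_def)

lemma matrix_inv_eqI:
  fixes A B :: "real^'n^'n"
  assumes "A ** B = mat 1"
  shows "matrix_inv A = B"
proof -
  have "invertible A"
    using assms matrix_left_right_inverse invertible_def by blast
  then have "matrix_inv A ** (A ** B) = B"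
    by (simp add: matrix_mul_assoc matrix_inv_mult)
  then show ?thesis
    by (simp add: assms)
qed

text \<open>The lower bound \<open>s * norm x \<le> norm (A *v x)\<close>, read at
  \<open>matrix_inv A *v x\<close>, bounds the inverse, and \<open>s\<close> is itself a singular
  value, so \<open>sigma_min A \<le> s\<close>.\<close>

lemma sigma_min_mult_spectral_norm_inv_le:
  fixes A :: "real^'n^'n"
  assumes "invertible A"
  shows "sigma_min A * spectral_norm (matrix_inv A) \<le> 1"
proof -
  obtain s where s0: "0 \<le> s" and mem: "s \<in> singular_values A"
      and s: "\<And>x. s * norm x \<le> norm (A *v x)"
    using minimal_stretch_singular_value by blast
  have inv: "s * norm (matrix_inv A *v x) \<le> norm x" for x
    using s[of "matrix_inv A *v x"] by (simp add: matrix_vector_mul_assoc matrix_inv_mult assms)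
  have "s * spectral_norm (matrix_inv A) \<le> 1"
  proof (cases "s = 0")
    case False
    have "spectral_norm (matrix_inv A) \<le> 1 / s"
      using inv s0 False by (intro onorm_le) (simp add: field_simps)
    then show ?thesis using s0 False by (simp add: field_simps)
  qed simp
  moreover have "sigma_min A \<le> s"
    unfolding sigma_min_def by (rule Min_le[OF finite_singular_values mem])
  ultimately show ?thesis
    using mult_right_mono[OF _ spectral_norm_nonneg, of "sigma_min A" s "matrix_inv A"] by simp
qed

section \<open>Perturbation of the Woodbury formula\<close>

lemma woodbury:
  fixes A :: "real^'n^'n" and U :: "real^'k^'n" and W :: "real^'n^'k"
  assumes "invertible A" and "invertible (mat 1 + W ** matrix_inv A ** U)"
  defines "K' \<equiv> matrix_inv (mat 1 + W ** matrix_inv A ** U)"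
  shows "matrix_inv (A + U ** W) = matrix_inv A - matrix_inv A ** U ** K' ** W ** matrix_inv A"
proof (rule matrix_inv_eqI)
  let ?M = "matrix_inv A"
  have AM: "A *v (?M *v x) = x" for x
    by (simp add: matrix_vector_mul_assoc matrix_inv_mult assms(1))
  have "(mat 1 + W ** ?M ** U) *v (K' *v y) = y" for y
    unfolding K'_def by (simp add: matrix_vector_mul_assoc matrix_inv_mult assms(2))
  then have K: "K' *v y = y - W *v (?M *v (U *v (K' *v y)))" for y
    by (simp add: matrix_vector_mult_add_rdistrib eq_diff_eq flip: matrix_vector_mul_assoc)
  have "((A + U ** W) ** (?M - ?M ** U ** K' ** W ** ?M)) *v x = x" for x
  proof -
    let ?y = "W *v (?M *v x)"
    \<comment> \<open>Expanding the product on \<open>x\<close> leaves \<open>x\<close> plus three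
      terms starting with \<open>U\<close>; the defining equation of \<open>K'\<close>, pushed
      through \<open>U\<close>, says that they cancel.\<close>
    have "U *v (K' *v ?y) = U *v ?y - U *v (W *v (?M *v (U *v (K' *v ?y))))"
      by (subst K) (rule matrix_vector_mult_diff_distrib)
    then show ?thesis
      by (simp add: algebra_simps AM flip: matrix_vector_mul_assoc)
  qed
  then show "(A + U ** W) ** (?M - ?M ** U ** K' ** W ** ?M) = mat 1"
    by (simp add: matrix_eq)
qed

text \<open>The resolvent identity: it turns a perturbation of \<open>K\<close> into one of its
  inverse.\<close>

lemma matrix_inv_diff:
  fixes K L :: "real^'n^'n"
  assumes "invertible K" and "invertible L"
  shows "matrix_inv L - matrix_inv K = matrix_inv L ** (K - L) ** matrix_inv K"
proof -
  have "K *v (matrix_inv K *v x) = x" "matrix_inv L *v (L *v x) = x" for x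
    by (simp_all add: matrix_vector_mul_assoc matrix_inv_mult assms)
  then show ?thesis
    by (simp add: matrix_eq algebra_simps flip: matrix_vector_mul_assoc)
qed

text \<open>Each product term exchanges a single factor, passing from \<open>M U K' W M\<close>
  through \<open>L'\<close> to \<open>N U Z W N\<close>.\<close>

lemma woodbury_error_split:
  fixes M N :: "real^'n^'n" and U :: "real^'k^'n" and W :: "real^'n^'k" and K' L' Z :: "real^'k^'k"
  shows "M - M ** U ** K' ** W ** M - (N - N ** U ** Z ** W ** N) =
    (M - N) + (N - M) ** U ** L' ** W ** N + M ** U ** (L' - K') ** W ** N
      + M ** U ** K' ** W ** (N - M) + N ** U ** (Z - L') ** W ** N"
  by (simp add: matrix_eq algebra_simps flip: matrix_vector_mul_assoc)

text \<open>With \<open>y\<close> the image of \<open>x\<close> under the inverse,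
  \<open>y = x - X y\<close>, and half of \<open>norm y\<close> is absorbed on the left.\<close>

lemma spectral_norm_inv_mat_1_add_le:
  fixes X :: "real^'n^'n"
  assumes "invertible (mat 1 + X)" and "spectral_norm X \<le> 1 / 2"
  shows "spectral_norm (matrix_inv (mat 1 + X)) \<le> 2"
proof (rule onorm_le)
  fix x :: "real^'n"
  let ?y = "matrix_inv (mat 1 + X) *v x"
  have "(mat 1 + X) *v ?y = x"
    by (simp add: matrix_vector_mul_assoc matrix_inv_mult assms(1))
  then have "?y = x - X *v ?y"
    by (simp add: matrix_vector_mult_add_rdistrib eq_diff_eq)
  then have "norm ?y \<le> norm x + norm (X *v ?y)"
    by (metis norm_triangle_ineq4)
  also have "norm (X *v ?y) \<le> 1 / 2 * norm ?y"
    using norm_matrix_vector_le[of X ?y] mult_right_mono[OF assms(2) norm_ge_zero[of ?y]] by linarith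
  finally show "norm ?y \<le> 2 * norm x" by simp
qed

theorem mainTheorem3:
  fixes A B Atinv :: "real ^ 'n ^ 'n"
    and U V :: "real ^ 'k ^ 'n"
    and Zinv :: "real ^ 'k ^ 'k"
    and \<epsilon>\<^sub>1 \<epsilon>\<^sub>2 lam \<alpha> :: real
  assumes "invertible A"
    and "rank U = CARD('k)" and "rank V = CARD('k)"
    and "invertible (mat 1 + transpose V ** matrix_inv A ** U)"
    and "B = A + U ** transpose V"
    and "invertible (mat 1 + transpose V ** Atinv ** U)"
    and "\<epsilon>\<^sub>1 = spectral_norm (Atinv - matrix_inv A)"
    and "\<epsilon>\<^sub>2 = spectral_norm (Zinv - matrix_inv (mat 1 + transpose V ** Atinv ** U))"
    and "lam = spectral_norm U * spectral_norm V"
    and "spectral_norm (matrix_inv (mat 1 + transpose V ** matrix_inv A ** U)) \<le> \<alpha>"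
    and "\<epsilon>\<^sub>1 \<le> 1" and "\<epsilon>\<^sub>2 \<le> 1" and "sigma_min A \<le> 1"
    and "\<epsilon>\<^sub>1 < 1 / (2 * lam * \<alpha>)"
    and "lam \<le> 1 / 2 * sigma_min A"
  shows "spectral_norm
           (matrix_inv B - (Atinv - Atinv ** U ** Zinv ** transpose V ** Atinv))
         \<le> 2 * \<epsilon>\<^sub>2 * spectral_norm (matrix_inv A) + 12 * \<epsilon>\<^sub>1"
proof -
  define M where "M = matrix_inv A"
  define N where "N = Atinv"
  define W where "W = transpose V"
  define K where "K = mat 1 + W ** M ** U"
  define L where "L = mat 1 + W ** N ** U"
  define K' where "K' = matrix_inv K"
  define L' where "L' = matrix_inv L"
  define a where "a = spectral_norm M"
  define u where "u = spectral_norm U"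
  define v where "v = spectral_norm V"
  define \<kappa> where "\<kappa> = spectral_norm K'"
  define l where "l = spectral_norm L'"
  have invK: "invertible K" and invL: "invertible L"
    using assms(4,6) by (simp_all add: K_def L_def M_def N_def W_def)
  have nonneg: "0 \<le> a" "0 \<le> u" "0 \<le> v" "0 \<le> \<kappa>" "0 \<le> l" "0 \<le> \<epsilon>\<^sub>1" "0 \<le> \<epsilon>\<^sub>2"
    by (simp_all only: a_def u_def v_def \<kappa>_def l_def assms(7,8) spectral_norm_nonneg)
  have lam: "lam = u * v" "0 \<le> lam"
    using nonneg by (simp_all add: assms(9) u_def v_def)
  have W: "spectral_norm W \<le> v"
    unfolding W_def v_def by (rule spectral_norm_transpose_le)
  have E: "spectral_norm (N - M) \<le> \<epsilon>\<^sub>1" "spectral_norm (M - N) \<le> \<epsilon>\<^sub>1"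
    using spectral_norm_diff_commute[of M N] by (simp_all add: N_def M_def assms(7))
  have N: "spectral_norm N \<le> a + \<epsilon>\<^sub>1"
    using spectral_norm_add_le[of M "N - M"] E(1) by (simp add: a_def)
  have Z: "spectral_norm (Zinv - L') \<le> \<epsilon>\<^sub>2"
    by (simp add: assms(8) L'_def L_def W_def N_def)
  have lam_half: "lam \<le> 1 / 2"
    using assms(13,15) by linarith
  have lam_a: "lam * a \<le> 1 / 2"
    using mult_right_mono[OF assms(15) nonneg(1)] sigma_min_mult_spectral_norm_inv_le[OF assms(1)]
    by (simp add: a_def M_def)
  \<comment> \<open>This lets \<open>U\<close>, \<open>W\<close> and one \<open>N\<close> together
    contribute at most 1, keeping extra powers of \<open>a\<close> out of the estimates.\<close>
  have lam_aN: "lam * (a + \<epsilon>\<^sub>1) \<le> 1"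
    using lam_a lam_half mult_mono[OF lam_half assms(11)] nonneg by (simp add: distrib_left)
  have U: "spectral_norm U \<le> u" and M: "spectral_norm M \<le> a"
    and K': "spectral_norm K' \<le> \<kappa>" and L': "spectral_norm L' \<le> l"
    by (simp_all add: u_def a_def \<kappa>_def l_def)

  \<comment> \<open>Bounds on the inverses of \<open>K\<close> and \<open>L\<close>\<close>
  have "spectral_norm (W ** M ** U) \<le> v * a * u"
    by (intro spectral_norm_mult_mono W M U)
  then have \<kappa>2: "\<kappa> \<le> 2"
    using spectral_norm_inv_mat_1_add_le[of "W ** M ** U"] invK lam_a
    by (simp add: \<kappa>_def K'_def K_def lam(1) mult_ac)

  text \<open>Division by zero yields zero, so the strict bound on \<open>\<epsilon>\<^sub>1\<close> also forces \<open>lam * \<alpha>\<close> to be positive.\<close>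
  have "0 < 1 / (2 * lam * \<alpha>)"
    using assms(14) nonneg(6) by linarith
  then have "0 < 2 * lam * \<alpha>"
    by (simp only: zero_less_divide_1_iff)
  then have "0 < lam * \<alpha>"
    by linarith
  then have "\<epsilon>\<^sub>1 * (lam * \<alpha>) < 1 / 2"
    using assms(14) by (simp add: field_simps)
  moreover have "\<epsilon>\<^sub>1 * (lam * \<kappa>) \<le> \<epsilon>\<^sub>1 * (lam * \<alpha>)"
    using assms(10) nonneg lam(2)
    by (intro mult_left_mono) (simp_all add: \<kappa>_def K'_def K_def M_def W_def)
  ultimately have small: "\<epsilon>\<^sub>1 * lam * \<kappa> \<le> 1 / 2"
    by simp

  have "K - L = W ** (M - N) ** U"
    by (simp add: K_def L_def matrix_eq algebra_simps flip: matrix_vector_mul_assoc)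
  then have "spectral_norm (K - L) \<le> v * \<epsilon>\<^sub>1 * u"
    using spectral_norm_mult_mono[OF spectral_norm_mult_mono[OF W E(2)] U] by simp
  then have "spectral_norm (L' - K') \<le> l * (v * \<epsilon>\<^sub>1 * u) * \<kappa>"
    unfolding L'_def K'_def matrix_inv_diff[OF invK invL] using L' K'
    by (intro spectral_norm_mult_mono) (simp_all add: L'_def K'_def)
  then have D: "spectral_norm (L' - K') \<le> l * (\<epsilon>\<^sub>1 * lam * \<kappa>)"
    by (simp add: lam(1) mult_ac)
  \<comment> \<open>The bound \<open>D\<close> contains \<open>l\<close> itself; with the factor 1/2
    it gives \<open>l \<le> 2 + l / 2\<close>.\<close>
  have "l * (\<epsilon>\<^sub>1 * lam * \<kappa>) \<le> l * (1 / 2)"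
    by (rule mult_left_mono[OF small nonneg(5)])
  then have l4: "l \<le> 4"
    using spectral_norm_add_le[of K' "L' - K'"] D \<kappa>2 by (simp add: l_def \<kappa>_def)

  \<comment> \<open>Bounds on the five error terms\<close>
  have T2: "spectral_norm ((N - M) ** U ** L' ** W ** N) \<le> 4 * \<epsilon>\<^sub>1"
  proof -
    have "spectral_norm ((N - M) ** U ** L' ** W ** N) \<le> \<epsilon>\<^sub>1 * u * l * v * (a + \<epsilon>\<^sub>1)"
      by (intro spectral_norm_mult_mono E U L' W N)
    also have "\<dots> = \<epsilon>\<^sub>1 * (l * (lam * (a + \<epsilon>\<^sub>1)))"
      by (simp add: lam(1) mult_ac)
    also have "\<dots> \<le> \<epsilon>\<^sub>1 * (4 * 1)"
      using l4 lam_aN nonneg lam(2) by (intro mult_left_mono mult_mono) auto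
    finally show ?thesis by simp
  qed
  have T3: "spectral_norm (M ** U ** (L' - K') ** W ** N) \<le> 4 * \<epsilon>\<^sub>1"
  proof -
    have "spectral_norm (M ** U ** (L' - K') ** W ** N)
        \<le> a * u * (l * (\<epsilon>\<^sub>1 * lam * \<kappa>)) * v * (a + \<epsilon>\<^sub>1)"
      by (intro spectral_norm_mult_mono M U D W N)
    \<comment> \<open>One \<open>lam\<close> comes from the outer \<open>U\<close> and
      \<open>W\<close>, the other from \<open>K - L\<close> inside \<open>D\<close>; they absorb
      \<open>M\<close> and \<open>N\<close> respectively.\<close>
    also have "\<dots> = \<epsilon>\<^sub>1 * ((l * \<kappa>) * ((lam * a) * (lam * (a + \<epsilon>\<^sub>1))))"
      by (simp add: lam(1) mult_ac)
    also have "\<dots> \<le> \<epsilon>\<^sub>1 * ((4 * 2) * ((1 / 2) * 1))"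
      using l4 \<kappa>2 lam_a lam_aN nonneg lam(2) by (intro mult_left_mono mult_mono) auto
    finally show ?thesis by simp
  qed
  have T4: "spectral_norm (M ** U ** K' ** W ** (N - M)) \<le> \<epsilon>\<^sub>1"
  proof -
    have "spectral_norm (M ** U ** K' ** W ** (N - M)) \<le> a * u * \<kappa> * v * \<epsilon>\<^sub>1"
      by (intro spectral_norm_mult_mono M U K' W E)
    also have "\<dots> = \<epsilon>\<^sub>1 * (\<kappa> * (lam * a))"
      by (simp add: lam(1) mult_ac)
    also have "\<dots> \<le> \<epsilon>\<^sub>1 * (2 * (1 / 2))"
      using \<kappa>2 lam_a nonneg lam(2) by (intro mult_left_mono mult_mono) auto
    finally show ?thesis by simp
  qed
  have T5: "spectral_norm (N ** U ** (Zinv - L') ** W ** N) \<le> \<epsilon>\<^sub>2 * a + \<epsilon>\<^sub>1"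
  proof -
    have "spectral_norm (N ** U ** (Zinv - L') ** W ** N) \<le> (a + \<epsilon>\<^sub>1) * u * \<epsilon>\<^sub>2 * v * (a + \<epsilon>\<^sub>1)"
      by (intro spectral_norm_mult_mono U Z W N)
    also have "\<dots> = \<epsilon>\<^sub>2 * (a + \<epsilon>\<^sub>1) * (lam * (a + \<epsilon>\<^sub>1))"
      by (simp add: lam(1) mult_ac)
    also have "\<dots> \<le> \<epsilon>\<^sub>2 * (a + \<epsilon>\<^sub>1) * 1"
      using lam_aN nonneg by (intro mult_left_mono) auto
    \<comment> \<open>One of the two factors \<open>N\<close> remains unabsorbed;
      \<open>\<epsilon>\<^sub>2 \<le> 1\<close> reduces its mixed term to
      \<open>\<epsilon>\<^sub>1\<close>.\<close>
    also have "\<dots> \<le> \<epsilon>\<^sub>2 * a + \<epsilon>\<^sub>1"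
      using mult_right_mono[OF assms(12) nonneg(6)] by (simp add: distrib_left)
    finally show ?thesis .
  qed

  have "matrix_inv B = M - M ** U ** K' ** W ** M"
    using woodbury[OF assms(1), of W U] invK
    by (simp add: assms(5) K'_def K_def M_def W_def)
  then have split: "matrix_inv B - (N - N ** U ** Zinv ** W ** N) =
      (M - N) + (N - M) ** U ** L' ** W ** N + M ** U ** (L' - K') ** W ** N
        + M ** U ** K' ** W ** (N - M) + N ** U ** (Zinv - L') ** W ** N"
    by (simp only: woodbury_error_split)
  have "spectral_norm (matrix_inv B - (N - N ** U ** Zinv ** W ** N))
      \<le> \<epsilon>\<^sub>1 + 4 * \<epsilon>\<^sub>1 + 4 * \<epsilon>\<^sub>1 + \<epsilon>\<^sub>1 + (\<epsilon>\<^sub>2 * a + \<epsilon>\<^sub>1)"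
    unfolding split by (intro order_trans[OF spectral_norm_add_le] add_mono E T2 T3 T4 T5)
  \<comment> \<open>The sum is \<open>\<epsilon>\<^sub>2 * a + 11 * \<epsilon>\<^sub>1\<close>,
    within the claimed constants.\<close>
  also have "\<dots> \<le> 2 * \<epsilon>\<^sub>2 * a + 12 * \<epsilon>\<^sub>1"
    using nonneg(6) mult_nonneg_nonneg[OF nonneg(7,1)] by linarith
  finally show ?thesis
    unfolding a_def N_def W_def M_def .
qed

end
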